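(* For any integer $k\ge 2$, $\gamma_L^k(G)-\gamma_L^k(G-e)$ can be arbitrarily large; that is, for every integer $k\ge 2$ and every integer $N$ there exist a connected graph $G$ and an edge $e\in E(G)$ with $G-e$ connected such that $\gamma_L^k(G)-\gamma_L^k(G-e)\ge N$.
   Context: All graphs are finite, simple and undirected. $G-e$ is the graph obtained from $G$ by deleting the edge $e$ (keeping all vertices). $d(x,y)$ is the length of a shortest path between $x$ and $y$ in the graph under consideration. For a positive integer $k$, let $d_k(x,y)=\min\{d(x,y),k+1\}$. A set $D\subseteq V(G)$ is a distance-$k$ dominating set of $G$ if for each $u\in V(G)\setminus D$ there is $w\in D$ with $d(u,w)\le k$. A set $S\subseteq V(G)$ is a distance-$k$ resolving set of $G$ if for any distinct $x,y\in V(G)$ there is $z\in S$ with $d_k(x,z)\ne d_k(y,z)$. A distance-$k$ locating-dominating set of $G$ is a set $S\subseteq V(G)$ that is both a distance-$k$ dominating set and a distance-$k$ resolving set of $G$; the distance-$k$ location-domination number $\gamma_L^k(G)$ is the minimum cardinality of such a set. *)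

theory Defs
  imports Main "HOL-Library.Extended_Nat"
begin

record 'a ugraph =
  verts :: "'a set"
  edges :: "'a set set"

definition finite_simple_graph :: "'a ugraph \<Rightarrow> bool" where
  "finite_simple_graph G \<longleftrightarrow>
     finite (verts G) \<and> (\<forall>e\<in>edges G. e \<subseteq> verts G \<and> card e = 2)"

definition del_edge :: "'a ugraph \<Rightarrow> 'a set \<Rightarrow> 'a ugraph" where
  "del_edge G e = G\<lparr>edges := edges G - {e}\<rparr>"

definition path_between :: "'a ugraph \<Rightarrow> 'a \<Rightarrow> 'a list \<Rightarrow> 'a \<Rightarrow> bool" where
  "path_between G x p y \<longleftrightarrow>
     p \<noteq> [] \<and> hd p = x \<and> last p = y \<and> distinct p \<and> set p \<subseteq> verts G \<and>
     successively (\<lambda>u v. {u, v} \<in> edges G) p"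

definition connected_graph :: "'a ugraph \<Rightarrow> bool" where
  "connected_graph G \<longleftrightarrow>
     verts G \<noteq> {} \<and> (\<forall>x\<in>verts G. \<forall>y\<in>verts G. \<exists>p. path_between G x p y)"

(* A path with n vertices has length n - 1. The distance is \<infinity> (the infimum of the
   empty set) if no path exists. *)
definition gdist :: "'a ugraph \<Rightarrow> 'a \<Rightarrow> 'a \<Rightarrow> enat" where
  "gdist G x y = (INF p \<in> {p. path_between G x p y}. enat (length p - 1))"

definition gdist_trunc :: "nat \<Rightarrow> 'a ugraph \<Rightarrow> 'a \<Rightarrow> 'a \<Rightarrow> enat" where
  "gdist_trunc k G x y = min (gdist G x y) (enat (k + 1))"

definition dist_dominating :: "nat \<Rightarrow> 'a ugraph \<Rightarrow> 'a set \<Rightarrow> bool" where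
  "dist_dominating k G D \<longleftrightarrow>
     D \<subseteq> verts G \<and> (\<forall>u\<in>verts G - D. \<exists>w\<in>D. gdist G u w \<le> enat k)"

definition dist_resolving :: "nat \<Rightarrow> 'a ugraph \<Rightarrow> 'a set \<Rightarrow> bool" where
  "dist_resolving k G S \<longleftrightarrow>
     S \<subseteq> verts G \<and>
     (\<forall>x\<in>verts G. \<forall>y\<in>verts G. x \<noteq> y \<longrightarrow>
        (\<exists>z\<in>S. gdist_trunc k G x z \<noteq> gdist_trunc k G y z))"

definition dist_locating_dominating :: "nat \<Rightarrow> 'a ugraph \<Rightarrow> 'a set \<Rightarrow> bool" where
  "dist_locating_dominating k G S \<longleftrightarrow> dist_dominating k G S \<and> dist_resolving k G S"

(* The minimum exists for every finite graph, since verts G itself is locating-dominating. *)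
definition location_domination_number :: "nat \<Rightarrow> 'a ugraph \<Rightarrow> nat" where
  "location_domination_number k G =
     (LEAST n. \<exists>S. dist_locating_dominating k G S \<and> card S = n)"

end

theory Submission
  imports Defs "HOL-Library.Nat_Bijection"
begin

text \<open>
  Take vertices \<open>u\<close>, \<open>v\<close>, \<open>z\<^sub>j\<close> for \<open>j < m\<close>, and triples \<open>a\<^sub>i\<close>, \<open>b\<^sub>i\<close>, \<open>c\<^sub>i\<close> for \<open>i < 2 ^ m\<close>. Both \<open>a\<^sub>i\<close> and
  \<open>b\<^sub>i\<close> are adjacent to \<open>v\<close> and to those \<open>z\<^sub>j\<close> for which bit \<open>j\<close> of \<open>i\<close> is set, and \<open>c\<^sub>i\<close> is adjacent to
  \<open>a\<^sub>i\<close> and \<open>u\<close>; finally \<open>e = uv\<close>. Without \<open>e\<close>, the distance to \<open>u\<close> is 1 from \<open>c\<^sub>i\<close>, 2 from \<open>a\<^sub>i\<close> and 4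
  from \<open>b\<^sub>i\<close>, and the \<open>z\<^sub>j\<close> read off the bits of \<open>i\<close>, so the \<open>m + 2\<close> vertices \<open>u\<close>, \<open>v\<close>, \<open>z\<^sub>j\<close> suffice.
  With \<open>e\<close>, the detour \<open>a\<^sub>i c\<^sub>i u\<close> is no shorter than \<open>b\<^sub>i v u\<close>, so \<open>a\<^sub>i\<close> and \<open>b\<^sub>i\<close> are equidistant from every
  vertex outside their own triple, and each of the \<open>2 ^ m\<close> triples must be hit.
\<close>

section \<open>Distances and walks\<close>

text \<open>As a relation, adjacency gives walks for free: a walk of length \<open>n\<close> is a
  pair in \<open>adj G ^^ n\<close>, and reachability is the reflexive transitive closure.\<close>

definition adj :: "'a ugraph \<Rightarrow> ('a \<times> 'a) set" where
  "adj G = {(x, y). {x, y} \<in> edges G}"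

lemma in_adj_iff: "(x, y) \<in> adj G \<longleftrightarrow> {x, y} \<in> edges G"
  by (simp add: adj_def)

lemma adj_sym: "(x, y) \<in> adj G \<longleftrightarrow> (y, x) \<in> adj G"
  by (simp add: adj_def insert_commute)

lemma adj_verts:
  assumes "finite_simple_graph G" "(x, y) \<in> adj G"
  shows "x \<in> verts G" "y \<in> verts G"
  using assms by (auto simp: finite_simple_graph_def adj_def)

lemma path_between_imp_relpow:
  assumes "path_between G x p y"
  shows "(x, y) \<in> adj G ^^ (length p - 1)"
  using assms
proof (induction p arbitrary: x)
  case Nil
  then show ?case by (simp add: path_between_def)
next
  case (Cons w p)
  show ?case
  proof (cases "p = []")
    case True
    then show ?thesis using Cons.prems by (auto simp: path_between_def)
  next
    case False
    have "path_between G (hd p) p y" "(x, hd p) \<in> adj G"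
      using Cons.prems False by (auto simp: path_between_def successively_Cons in_adj_iff)
    then have "(x, y) \<in> adj G ^^ Suc (length p - 1)"
      using Cons.IH by (meson relpow_Suc_I2)
    then show ?thesis using False by (cases p) auto
  qed
qed

text \<open>A path from the second vertex of the walk is extended by \<open>x\<close>; if
  \<open>x\<close> already lies on it, the loop before \<open>x\<close> is cut off instead. Cutting
  shortens, hence only \<open>\<le> n\<close>.\<close>

lemma relpow_imp_path_between:
  assumes "finite_simple_graph G" "(x, y) \<in> adj G ^^ n" "x \<in> verts G"
  shows "\<exists>p. path_between G x p y \<and> length p - 1 \<le> n"
  using assms(2,3)
proof (induction n arbitrary: x)
  case 0
  then have "path_between G x [x] y" by (simp add: path_between_def)
  then show ?case by (metis diff_Suc_1 length_Cons list.size(3) order_refl)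
next
  case (Suc n)
  from Suc.prems obtain w where w: "(x, w) \<in> adj G" "(w, y) \<in> adj G ^^ n"
    by (meson relpow_Suc_D2)
  with Suc.IH adj_verts[OF assms(1)] obtain p
    where p: "path_between G w p y" "length p - 1 \<le> n" by blast
  show ?case
  proof (cases "x \<in> set p")
    case True
    then obtain q r where q: "p = q @ x # r" by (meson split_list)
    then have "path_between G x (x # r) y"
      using p by (auto simp: path_between_def successively_append_iff)
    moreover have "length (x # r) - 1 \<le> Suc n" using p q by simp
    ultimately show ?thesis by blast
  next
    case False
    then have "path_between G x (x # p) y"
      using p w Suc.prems by (auto simp: path_between_def successively_Cons in_adj_iff)
    moreover have "length (x # p) - 1 \<le> Suc n" using p by simp
    ultimately show ?thesis by blast
  qed
qed

text \<open>Distances are handled only through finite thresholds, so that walks, which compose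
  freely, replace simple paths and infima.\<close>

lemma gdist_le_iff:
  assumes "finite_simple_graph G" "x \<in> verts G"
  shows "gdist G x y \<le> enat n \<longleftrightarrow> (\<exists>l\<le>n. (x, y) \<in> adj G ^^ l)"
proof
  assume "gdist G x y \<le> enat n"
  \<comment> \<open>A strict bound on an infimum yields a path as witness.\<close>
  then have "gdist G x y < enat (Suc n)"
    by (meson enat_ord_simps(2) le_less_trans lessI)
  then obtain p where "path_between G x p y" "enat (length p - 1) < enat (Suc n)"
    unfolding gdist_def by (auto simp: INF_less_iff)
  then show "\<exists>l\<le>n. (x, y) \<in> adj G ^^ l"
    using path_between_imp_relpow by (metis enat_ord_simps(2) less_Suc_eq_le)
next
  assume "\<exists>l\<le>n. (x, y) \<in> adj G ^^ l"
  then obtain p where "path_between G x p y" "length p - 1 \<le> n"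
    using relpow_imp_path_between[OF assms(1) _ assms(2)] by (meson le_trans)
  then show "gdist G x y \<le> enat n"
    unfolding gdist_def by (meson INF_lower2 enat_ord_simps(1) mem_Collect_eq)
qed

lemma gdist_le_0_iff:
  assumes "finite_simple_graph G" "x \<in> verts G"
  shows "gdist G x y \<le> enat 0 \<longleftrightarrow> x = y"
  by (simp add: gdist_le_iff[OF assms])

lemma gdist_le_1_iff:
  assumes "finite_simple_graph G" "x \<in> verts G"
  shows "gdist G x y \<le> enat 1 \<longleftrightarrow> x = y \<or> (x, y) \<in> adj G"
proof -
  have "(\<exists>l\<le>1. P l) \<longleftrightarrow> P 0 \<or> P 1" for P :: "nat \<Rightarrow> bool"
    by (auto simp: le_Suc_eq)
  then show ?thesis
    by (simp add: gdist_le_iff[OF assms])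
qed

lemma gdist_le_2_iff:
  assumes "finite_simple_graph G" "x \<in> verts G"
  shows "gdist G x y \<le> enat 2 \<longleftrightarrow> x = y \<or> (x, y) \<in> adj G \<or> (\<exists>w. (x, w) \<in> adj G \<and> (w, y) \<in> adj G)"
proof -
  have "(\<exists>l\<le>2. P l) \<longleftrightarrow> P 0 \<or> P 1 \<or> P 2" for P :: "nat \<Rightarrow> bool"
    by (auto simp: numeral_2_eq_2 le_Suc_eq)
  then show ?thesis
    by (auto simp: gdist_le_iff[OF assms] numeral_2_eq_2 relcomp_unfold)
qed

lemma enat_eqI:
  fixes s t :: enat
  assumes "\<And>n. s \<le> enat n \<longleftrightarrow> t \<le> enat n"
  shows "s = t"
  using assms by (metis enat.exhaust enat_ord_code(3) enat_ord_simps(1) infinity_ileE nle_le)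

text \<open>Truncation at \<open>k + 1\<close> is invisible to every threshold up to
  \<open>k\<close>.\<close>

lemma gdist_trunc_eqD:
  assumes "gdist_trunc k G x z = gdist_trunc k G y z" "n \<le> k"
  shows "gdist G x z \<le> enat n \<longleftrightarrow> gdist G y z \<le> enat n"
proof -
  have "gdist_trunc k G w z \<le> enat n \<longleftrightarrow> gdist G w z \<le> enat n" for w
    using assms(2) by (auto simp: gdist_trunc_def min_le_iff_disj)
  then show ?thesis using assms(1) by metis
qed

lemma connected_graphI:
  assumes "finite_simple_graph G" "v \<in> verts G" "\<And>x. x \<in> verts G \<Longrightarrow> (x, v) \<in> (adj G)\<^sup>*"
  shows "connected_graph G"
  unfolding connected_graph_def
proof (intro conjI ballI)
  show "verts G \<noteq> {}" using assms(2) by blast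
  fix x y assume xy: "x \<in> verts G" "y \<in> verts G"
  have "sym ((adj G)\<^sup>*)" by (intro sym_rtrancl symI) (simp add: adj_sym)
  then have "(x, y) \<in> (adj G)\<^sup>*"
    using assms(3) xy by (meson rtrancl_trans symE)
  then show "\<exists>p. path_between G x p y"
    using relpow_imp_path_between[OF assms(1)] xy by (metis rtrancl_imp_relpow)
qed

lemma verts_del_edge [simp]: "verts (del_edge G e) = verts G"
  by (simp add: del_edge_def)

text \<open>Paths survive putting \<open>e\<close> back, so connectedness has to be checked only
  without the edge.\<close>

lemma connected_graph_del_edgeD:
  assumes "connected_graph (del_edge G e)"
  shows "connected_graph G"
proof -
  have "path_between G x p y" if "path_between (del_edge G e) x p y" for x p y
    using that successively_mono[of "\<lambda>u v. {u, v} \<in> edges (del_edge G e)" p "\<lambda>u v. {u, v} \<in> edges G"]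
    by (auto simp: path_between_def del_edge_def)
  then show ?thesis
    using assms unfolding connected_graph_def verts_del_edge by meson
qed

section \<open>Bounds on the location-domination number\<close>

text \<open>A member of \<open>S\<close> is separated from every other vertex by its own distance 0
  to itself, so only pairs outside \<open>S\<close> matter.\<close>

lemma dist_resolvingI:
  assumes "finite_simple_graph G" "S \<subseteq> verts G"
    and sep: "\<And>x y. x \<in> verts G - S \<Longrightarrow> y \<in> verts G - S \<Longrightarrow>
      (\<And>z n. z \<in> S \<Longrightarrow> n \<le> k \<Longrightarrow> gdist G x z \<le> enat n \<longleftrightarrow> gdist G y z \<le> enat n) \<Longrightarrow> x = y"
  shows "dist_resolving k G S"
  unfolding dist_resolving_def
proof (intro conjI ballI impI, rule assms(2))
  fix x y assume xy: "x \<in> verts G" "y \<in> verts G" "x \<noteq> y"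
  show "\<exists>z\<in>S. gdist_trunc k G x z \<noteq> gdist_trunc k G y z"
  proof (rule ccontr)
    assume "\<not> ?thesis"
    then have trunc: "gdist_trunc k G x z = gdist_trunc k G y z" if "z \<in> S" for z
      using that by simp
    have eq: "gdist G x z \<le> enat n \<longleftrightarrow> gdist G y z \<le> enat n" if "z \<in> S" "n \<le> k" for z n
      using trunc[OF that(1)] that(2) by (rule gdist_trunc_eqD)
    have "x = z \<longleftrightarrow> y = z" if "z \<in> S" for z
      using eq[OF that, of 0] xy by (simp add: gdist_le_0_iff[OF assms(1)])
    then have "x \<notin> S" "y \<notin> S" using xy(3) by metis+
    then have "x = y" using xy by (intro sep eq) simp+
    then show False using xy(3) by simp
  qed
qed

lemma location_domination_number_le:
  assumes "dist_locating_dominating k G S"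
  shows "location_domination_number k G \<le> card S"
  unfolding location_domination_number_def using assms by (intro Least_le) blast

lemma dist_locating_dominating_verts:
  assumes "finite_simple_graph G"
  shows "dist_locating_dominating k G (verts G)"
  using dist_resolvingI[OF assms order_refl]
  by (simp add: dist_locating_dominating_def dist_dominating_def)

lemma location_domination_number_ge:
  assumes "finite_simple_graph G" "\<And>S. dist_locating_dominating k G S \<Longrightarrow> n \<le> card S"
  shows "n \<le> location_domination_number k G"
proof -
  have "\<exists>S. dist_locating_dominating k G S \<and> card S = location_domination_number k G"
    unfolding location_domination_number_def
    by (rule LeastI_ex) (use dist_locating_dominating_verts[OF assms(1)] in blast)
  then show ?thesis using assms(2) by force
qed

text \<open>Picking an element of \<open>S\<close> from each \<open>T i\<close> is injective by
  disjointness.\<close>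

lemma card_ge_if_disjoint_family_hit:
  assumes "finite S" "finite I" "\<And>i. i \<in> I \<Longrightarrow> T i \<inter> S \<noteq> {}"
    and "\<And>i j. i \<in> I \<Longrightarrow> j \<in> I \<Longrightarrow> i \<noteq> j \<Longrightarrow> T i \<inter> T j = {}"
  shows "card I \<le> card S"
proof -
  have "\<forall>i\<in>I. \<exists>x. x \<in> T i \<inter> S" using assms(3) by blast
  then obtain f where f: "\<forall>i\<in>I. f i \<in> T i \<inter> S" using bchoice by metis
  have "inj_on f I"
  proof (rule inj_onI)
    fix i j assume "i \<in> I" "j \<in> I" "f i = f j"
    moreover from this have "f i \<in> T i \<inter> T j" using f by (metis IntD1 IntI)
    ultimately show "i = j" using assms(4) by blast
  qed
  moreover have "f ` I \<subseteq> S" using f by blast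
  ultimately show ?thesis using assms(1) by (metis card_inj_on_le)
qed

section \<open>The graph\<close>

text \<open>The first component of the pair is a tag for the kind of vertex; it keeps the six kinds
  apart inside \<open>nat\<close>.\<close>

definition va :: "nat \<Rightarrow> nat" where "va i = prod_encode (0, i)"
definition vb :: "nat \<Rightarrow> nat" where "vb i = prod_encode (1, i)"
definition vc :: "nat \<Rightarrow> nat" where "vc i = prod_encode (2, i)"
definition vz :: "nat \<Rightarrow> nat" where "vz j = prod_encode (3, j)"
definition vu :: nat where "vu = prod_encode (4, 0)"
definition vv :: nat where "vv = prod_encode (5, 0)"

lemma vertex_inject [simp]:
  "va i = va i' \<longleftrightarrow> i = i'" "vb i = vb i' \<longleftrightarrow> i = i'" "vc i = vc i' \<longleftrightarrow> i = i'" "vz j = vz j' \<longleftrightarrow> j = j'"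
  by (simp add: va_def vb_def vc_def vz_def prod_encode_eq)+

lemma vertex_distinct [simp]:
  "va i \<noteq> vb i'" "va i \<noteq> vc i'" "va i \<noteq> vz j" "va i \<noteq> vu" "va i \<noteq> vv"
  "vb i \<noteq> vc i'" "vb i \<noteq> vz j" "vb i \<noteq> vu" "vb i \<noteq> vv"
  "vc i \<noteq> vz j" "vc i \<noteq> vu" "vc i \<noteq> vv"
  "vz j \<noteq> vu" "vz j \<noteq> vv" "vu \<noteq> vv"
  by (simp add: va_def vb_def vc_def vz_def vu_def vv_def prod_encode_eq)+

lemmas vertex_distinct' [simp] = vertex_distinct[symmetric]

definition bit_edges :: "nat \<Rightarrow> nat set set" where
  "bit_edges m =
     {{va i, vv} |i. i < 2 ^ m} \<union> {{vb i, vv} |i. i < 2 ^ m} \<union>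
     {{va i, vc i} |i. i < 2 ^ m} \<union> {{vc i, vu} |i. i < 2 ^ m} \<union>
     {{va i, vz j} |i j. i < 2 ^ m \<and> j < m \<and> bit i j} \<union>
     {{vb i, vz j} |i j. i < 2 ^ m \<and> j < m \<and> bit i j}"

definition bit_graph :: "nat \<Rightarrow> nat ugraph" where
  "bit_graph m =
     \<lparr>verts = {vu, vv} \<union> vz ` {..<m} \<union> va ` {..<2 ^ m} \<union> vb ` {..<2 ^ m} \<union> vc ` {..<2 ^ m},
      edges = insert {vu, vv} (bit_edges m)\<rparr>"

abbreviation bit_graph_del :: "nat \<Rightarrow> nat ugraph" where
  "bit_graph_del m \<equiv> del_edge (bit_graph m) {vu, vv}"

lemma edges_bit_graph_del: "edges (bit_graph_del m) = bit_edges m"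
  by (auto simp: del_edge_def bit_graph_def bit_edges_def doubleton_eq_iff)

lemma finite_simple_bit_graph: "finite_simple_graph (bit_graph m)"
  by (auto simp: finite_simple_graph_def bit_graph_def bit_edges_def)

lemma finite_simple_bit_graph_del: "finite_simple_graph (bit_graph_del m)"
  using finite_simple_bit_graph by (auto simp: finite_simple_graph_def del_edge_def)

lemma verts_bit_graph:
  "verts (bit_graph m) =
     {vu, vv} \<union> vz ` {..<m} \<union> va ` {..<2 ^ m} \<union> vb ` {..<2 ^ m} \<union> vc ` {..<2 ^ m}"
  by (simp add: bit_graph_def)

lemma in_verts_bit_graph:
  "vu \<in> verts (bit_graph m)" "vv \<in> verts (bit_graph m)"
  "j < m \<Longrightarrow> vz j \<in> verts (bit_graph m)"
  "i < 2 ^ m \<Longrightarrow> va i \<in> verts (bit_graph m)" "i < 2 ^ m \<Longrightarrow> vb i \<in> verts (bit_graph m)"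
  "i < 2 ^ m \<Longrightarrow> vc i \<in> verts (bit_graph m)"
  by (force simp: verts_bit_graph)+

text \<open>Every edge has an endpoint in some triple, so adjacency at \<open>vv\<close> and
  \<open>vz j\<close> follows from these rules by \<open>adj_sym\<close>.\<close>

lemma adj_bit_graph_del:
  "(vu, x) \<in> adj (bit_graph_del m) \<longleftrightarrow> (\<exists>i<2 ^ m. x = vc i)"
  "(va i, x) \<in> adj (bit_graph_del m) \<longleftrightarrow>
     i < 2 ^ m \<and> (x = vv \<or> x = vc i \<or> (\<exists>j<m. bit i j \<and> x = vz j))"
  "(vb i, x) \<in> adj (bit_graph_del m) \<longleftrightarrow> i < 2 ^ m \<and> (x = vv \<or> (\<exists>j<m. bit i j \<and> x = vz j))"
  "(vc i, x) \<in> adj (bit_graph_del m) \<longleftrightarrow> i < 2 ^ m \<and> (x = va i \<or> x = vu)"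
  by (force simp: in_adj_iff edges_bit_graph_del bit_edges_def doubleton_eq_iff)+

lemma adj_bit_graph:
  "(x, y) \<in> adj (bit_graph m) \<longleftrightarrow>
     (x, y) \<in> adj (bit_graph_del m) \<or> x = vu \<and> y = vv \<or> x = vv \<and> y = vu"
  unfolding in_adj_iff edges_bit_graph_del by (auto simp: bit_graph_def doubleton_eq_iff)

lemma connected_bit_graph_del: "connected_graph (bit_graph_del m)"
proof (rule connected_graphI[OF finite_simple_bit_graph_del])
  let ?r = "adj (bit_graph_del m)"
  show "vv \<in> verts (bit_graph_del m)" by (simp add: in_verts_bit_graph)
  fix x assume "x \<in> verts (bit_graph_del m)"
  then have x: "x \<in> verts (bit_graph m)" by simp
  have a: "(va i, vv) \<in> ?r\<^sup>*" if "i < 2 ^ m" for i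
    using that by (intro r_into_rtrancl) (simp add: adj_bit_graph_del)
  have b: "(vb i, vv) \<in> ?r\<^sup>*" if "i < 2 ^ m" for i
    using that by (intro r_into_rtrancl) (simp add: adj_bit_graph_del)
  have c: "(vc i, vv) \<in> ?r\<^sup>*" if "i < 2 ^ m" for i
    using that by (intro converse_rtrancl_into_rtrancl[OF _ a[OF that]]) (simp add: adj_bit_graph_del)
  have u: "(vu, vv) \<in> ?r\<^sup>*"
    by (intro converse_rtrancl_into_rtrancl[OF _ c[of 0]]) (auto simp: adj_bit_graph_del)
  \<comment> \<open>The index \<open>2 ^ j\<close> is below \<open>2 ^ m\<close> and has bit
    \<open>j\<close> set, so \<open>va (2 ^ j)\<close> is a neighbour of
    \<open>vz j\<close>.\<close>
  have z: "(vz j, vv) \<in> ?r\<^sup>*" if "j < m" for j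
    using that by (intro converse_rtrancl_into_rtrancl[OF _ a[of "2 ^ j"]])
      (simp add: adj_sym[of "vz j"] adj_bit_graph_del bit_exp_iff)+
  show "(x, vv) \<in> ?r\<^sup>*"
    using x by (auto simp: verts_bit_graph a b c u z)
qed

section \<open>Upper bound without the edge\<close>

abbreviation landmarks :: "nat \<Rightarrow> nat set" where
  "landmarks m \<equiv> {vu, vv} \<union> vz ` {..<m}"

lemma landmarks_subset_verts: "landmarks m \<subseteq> verts (bit_graph_del m)"
  by (auto simp: in_verts_bit_graph)

lemma verts_bit_graph_nonlandmark:
  assumes "w \<in> verts (bit_graph_del m) - landmarks m"
  shows "(\<exists>i<2 ^ m. w = va i) \<or> (\<exists>i<2 ^ m. w = vb i) \<or> (\<exists>i<2 ^ m. w = vc i)"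
  using assms by (auto simp: verts_bit_graph)

lemma bit_graph_del_dominating:
  assumes "k \<ge> 1"
  shows "dist_dominating k (bit_graph_del m) (landmarks m)"
  unfolding dist_dominating_def
proof (intro conjI ballI landmarks_subset_verts)
  fix x assume x: "x \<in> verts (bit_graph_del m) - landmarks m"
  from verts_bit_graph_nonlandmark[OF x]
  have "(x, vu) \<in> adj (bit_graph_del m) \<or> (x, vv) \<in> adj (bit_graph_del m)"
    by (auto simp: adj_bit_graph_del)
  then obtain w where w: "w \<in> landmarks m" "(x, w) \<in> adj (bit_graph_del m)" by blast
  from w(2) have "gdist (bit_graph_del m) x w \<le> enat 1"
    unfolding gdist_le_1_iff[OF finite_simple_bit_graph_del DiffD1[OF x]] by blast
  also have "enat 1 \<le> enat k" using assms by simp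
  finally show "\<exists>w\<in>landmarks m. gdist (bit_graph_del m) x w \<le> enat k" using w(1) by blast
qed

lemma adj_bit_graph_del_vu_iff:
  "(w, vu) \<in> adj (bit_graph_del m) \<longleftrightarrow> (\<exists>i<2 ^ m. w = vc i)"
  by (simp add: adj_sym[of _ vu] adj_bit_graph_del)

text \<open>The neighbours of \<open>vu\<close> are the \<open>vc i\<close>, and each of these has
  only \<open>va i\<close> as a further neighbour. The case \<open>w = vu\<close> is excluded
  because of the walk back and forth.\<close>

lemma path2_bit_graph_del_vu_iff:
  assumes "w \<noteq> vu"
  shows "(\<exists>w'. (w, w') \<in> adj (bit_graph_del m) \<and> (w', vu) \<in> adj (bit_graph_del m)) \<longleftrightarrow>
    (\<exists>i<2 ^ m. w = va i)"
proof -
  have "(\<exists>w'. (w, w') \<in> adj (bit_graph_del m) \<and> (w', vu) \<in> adj (bit_graph_del m)) \<longleftrightarrow>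
      (\<exists>i<2 ^ m. (vc i, w) \<in> adj (bit_graph_del m))"
    by (auto simp: adj_bit_graph_del_vu_iff adj_sym[of w])
  then show ?thesis using assms by (simp add: adj_bit_graph_del(4))
qed

text \<open>Of the two neighbours of \<open>vc i\<close>, \<open>vu\<close> sees no
  \<open>vz j\<close>, so the walk must pass through \<open>va i\<close>.\<close>

lemma path2_bit_graph_del_vz_iff:
  assumes "i < 2 ^ m" "j < m"
  shows "(\<exists>w. (vc i, w) \<in> adj (bit_graph_del m) \<and> (w, vz j) \<in> adj (bit_graph_del m)) \<longleftrightarrow> bit i j"
proof -
  have "(\<exists>w. (vc i, w) \<in> adj (bit_graph_del m) \<and> (w, vz j) \<in> adj (bit_graph_del m)) \<longleftrightarrow>
      (va i, vz j) \<in> adj (bit_graph_del m) \<or> (vu, vz j) \<in> adj (bit_graph_del m)"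
    using assms(1) by (auto simp: adj_bit_graph_del(4))
  then show ?thesis using assms by (simp add: adj_bit_graph_del)
qed

lemma nat_eq_if_low_bits_eq:
  fixes i i' :: nat
  assumes "i < 2 ^ m" "i' < 2 ^ m" "\<And>j. j < m \<Longrightarrow> bit i j \<longleftrightarrow> bit i' j"
  shows "i = i'"
proof -
  have "take_bit m i = take_bit m i'"
    using assms(3) by (auto intro!: bit_eqI simp: bit_take_bit_iff)
  then show ?thesis using assms(1,2) by (simp add: take_bit_nat_eq_self)
qed

text \<open>The thresholds 1 and 2 at \<open>vu\<close> reveal the kind of a vertex; those at the
  \<open>vz j\<close> then reveal the bits of its index.\<close>

lemma bit_graph_del_separated:
  assumes x: "x \<in> verts (bit_graph_del m) - landmarks m"
    and y: "y \<in> verts (bit_graph_del m) - landmarks m"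
    and le1: "\<And>z. z \<in> landmarks m \<Longrightarrow>
      gdist (bit_graph_del m) x z \<le> enat 1 \<longleftrightarrow> gdist (bit_graph_del m) y z \<le> enat 1"
    and le2: "\<And>z. z \<in> landmarks m \<Longrightarrow>
      gdist (bit_graph_del m) x z \<le> enat 2 \<longleftrightarrow> gdist (bit_graph_del m) y z \<le> enat 2"
  shows "x = y"
proof -
  let ?r = "adj (bit_graph_del m)"
  note verts = DiffD1[OF x] DiffD1[OF y]
  have not_landmark: "x \<notin> landmarks m" "y \<notin> landmarks m" using x y by simp+
  have near: "(x, z) \<in> ?r \<longleftrightarrow> (y, z) \<in> ?r" if "z \<in> landmarks m" for z
  proof -
    have "x \<noteq> z" "y \<noteq> z" using that not_landmark by metis+
    then show ?thesis
      using le1[OF that]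
      unfolding verts[THEN gdist_le_1_iff[OF finite_simple_bit_graph_del]] by simp
  qed
  have mid: "(x, z) \<in> ?r \<or> (\<exists>w. (x, w) \<in> ?r \<and> (w, z) \<in> ?r) \<longleftrightarrow>
      (y, z) \<in> ?r \<or> (\<exists>w. (y, w) \<in> ?r \<and> (w, z) \<in> ?r)" if "z \<in> landmarks m" for z
  proof -
    have "x \<noteq> z" "y \<noteq> z" using that not_landmark by metis+
    then show ?thesis
      using le2[OF that]
      unfolding verts[THEN gdist_le_2_iff[OF finite_simple_bit_graph_del]] by simp
  qed
  have "x \<noteq> vu" "y \<noteq> vu" using not_landmark by simp+
  then have x_iff: "(\<exists>w. (x, w) \<in> ?r \<and> (w, vu) \<in> ?r) \<longleftrightarrow> (\<exists>i<2 ^ m. x = va i)"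
    and y_iff: "(\<exists>w. (y, w) \<in> ?r \<and> (w, vu) \<in> ?r) \<longleftrightarrow> (\<exists>i<2 ^ m. y = va i)"
    by (simp only: path2_bit_graph_del_vu_iff not_False_eq_True)+
  have c: "(\<exists>i<2 ^ m. x = vc i) \<longleftrightarrow> (\<exists>i<2 ^ m. y = vc i)"
    using near[of vu] by (simp add: adj_bit_graph_del_vu_iff)
  have "(\<exists>i<2 ^ m. x = vc i) \<or> (\<exists>i<2 ^ m. x = va i) \<longleftrightarrow>
      (\<exists>i<2 ^ m. y = vc i) \<or> (\<exists>i<2 ^ m. y = va i)"
    using mid[of vu] unfolding x_iff y_iff unfolding adj_bit_graph_del_vu_iff by simp
  \<comment> \<open>Vertices within distance 2 of \<open>vu\<close> are of kind \<open>vc\<close> or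
    \<open>va\<close>, and kind \<open>vc\<close> is already settled by adjacency to
    \<open>vu\<close>.\<close>
  then have a: "(\<exists>i<2 ^ m. x = va i) \<longleftrightarrow> (\<exists>i<2 ^ m. y = va i)"
    using c by auto
  from verts_bit_graph_nonlandmark[OF x] show ?thesis
  proof (elim disjE exE conjE)
    fix i assume i: "i < 2 ^ m" "x = va i"
    with a obtain i' where i': "i' < 2 ^ m" "y = va i'" by blast
    have "bit i j \<longleftrightarrow> bit i' j" if "j < m" for j
      using near[of "vz j"] i i' that by (simp add: adj_bit_graph_del)
    then show ?thesis using nat_eq_if_low_bits_eq i i' by blast
  next
    fix i assume i: "i < 2 ^ m" "x = vb i"
    have "\<not> (\<exists>i<2 ^ m. y = va i)" "\<not> (\<exists>i<2 ^ m. y = vc i)"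
      unfolding a[symmetric] c[symmetric] using i by simp+
    with verts_bit_graph_nonlandmark[OF y]
    obtain i' where i': "i' < 2 ^ m" "y = vb i'" by blast
    have "bit i j \<longleftrightarrow> bit i' j" if "j < m" for j
      using near[of "vz j"] i i' that by (simp add: adj_bit_graph_del)
    then show ?thesis using nat_eq_if_low_bits_eq i i' by blast
  next
    fix i assume i: "i < 2 ^ m" "x = vc i"
    with c obtain i' where i': "i' < 2 ^ m" "y = vc i'" by blast
    \<comment> \<open>No \<open>vc l\<close> touches a \<open>vz j\<close>, so the bits are read at
      threshold 2 here, not at threshold 1.\<close>
    have no_edge: "(vc l, vz j) \<notin> ?r" for l j by (simp add: adj_bit_graph_del)
    have "bit i j \<longleftrightarrow> bit i' j" if "j < m" for j
      using mid[of "vz j"] i i' that by (simp add: no_edge path2_bit_graph_del_vz_iff)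
    then show ?thesis using nat_eq_if_low_bits_eq i i' by blast
  qed
qed

text \<open>For \<open>k \<ge> 2\<close> both thresholds used for separation lie below the
  truncation value.\<close>

lemma bit_graph_del_resolving:
  assumes "k \<ge> 2"
  shows "dist_resolving k (bit_graph_del m) (landmarks m)"
proof (rule dist_resolvingI[OF finite_simple_bit_graph_del landmarks_subset_verts])
  fix x y
  assume xy: "x \<in> verts (bit_graph_del m) - landmarks m" "y \<in> verts (bit_graph_del m) - landmarks m"
    and eq: "\<And>z n. z \<in> landmarks m \<Longrightarrow> n \<le> k \<Longrightarrow>
      gdist (bit_graph_del m) x z \<le> enat n \<longleftrightarrow> gdist (bit_graph_del m) y z \<le> enat n"
  show "x = y"
  proof (rule bit_graph_del_separated[OF xy])
    fix z assume "z \<in> landmarks m"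
    then show "gdist (bit_graph_del m) x z \<le> enat 1 \<longleftrightarrow> gdist (bit_graph_del m) y z \<le> enat 1"
      and "gdist (bit_graph_del m) x z \<le> enat 2 \<longleftrightarrow> gdist (bit_graph_del m) y z \<le> enat 2"
      by (rule eq; use assms in linarith)+
  qed
qed

lemma bit_graph_del_locating_dominating:
  assumes "k \<ge> 2"
  shows "dist_locating_dominating k (bit_graph_del m) (landmarks m)"
  using assms bit_graph_del_dominating bit_graph_del_resolving
  by (simp add: dist_locating_dominating_def)

section \<open>Lower bound with the edge\<close>

text \<open>The neighbours of \<open>va i\<close> are those of \<open>vb i\<close> together with
  \<open>vc i\<close>. A walk to \<open>w\<close> from either twin is thus turned into a walk from
  the other that is no longer; only a first step from \<open>va i\<close> to \<open>vc i\<close>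
  needs rerouting.\<close>

lemma bit_graph_twins_equidistant:
  assumes "i < 2 ^ m" "w \<notin> {va i, vb i, vc i}"
  shows "gdist (bit_graph m) (va i) w = gdist (bit_graph m) (vb i) w"
proof (rule enat_eqI)
  fix n
  let ?r = "adj (bit_graph m)"
  have ab: "\<exists>l\<le>n. (vb i, w) \<in> ?r ^^ l" if "(va i, w) \<in> ?r ^^ n" for n
    using that
  proof (induction n rule: less_induct)
    case (less n)
    obtain n' where n': "n = Suc n'" using less.prems assms by (cases n) auto
    with less.prems obtain y where y: "(va i, y) \<in> ?r" "(y, w) \<in> ?r ^^ n'"
      by (meson relpow_Suc_D2)
    show ?case
    proof (cases "y = vc i")
      case False
      then have "(vb i, y) \<in> ?r" using y by (auto simp: adj_bit_graph adj_bit_graph_del)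
      then show ?thesis using y n' by (meson order_refl relpow_Suc_I2)
    next
      case True
      \<comment> \<open>The walk cannot end at \<open>vc i\<close>, since \<open>w\<close> lies
        outside the triple.\<close>
      then obtain n'' where n'': "n' = Suc n''" using y assms by (cases n') auto
      with y obtain y' where y': "(vc i, y') \<in> ?r" "(y', w) \<in> ?r ^^ n''"
        using True by (meson relpow_Suc_D2)
      then consider "y' = va i" | "y' = vu" by (auto simp: adj_bit_graph adj_bit_graph_del)
      then show ?thesis
      proof cases
        case 1
        \<comment> \<open>The walk has returned to \<open>va i\<close> after two steps; the rest is
          a shorter walk from there.\<close>
        then show ?thesis using less.IH[of n''] y' n' n'' by (metis le_SucI lessI less_SucI)
      next
        case 2
        \<comment> \<open>The edge between \<open>vu\<close> and \<open>vv\<close> enters here: the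
          start \<open>va i\<close>, \<open>vc i\<close>, \<open>vu\<close> is exchanged for
          \<open>vb i\<close>, \<open>vv\<close>, \<open>vu\<close>, of equal length.\<close>
        have "(vb i, vv) \<in> ?r" "(vv, vu) \<in> ?r"
          using assms by (auto simp: adj_bit_graph adj_bit_graph_del)
        then have "(vb i, w) \<in> ?r ^^ n" using 2 y' n' n'' by (metis relpow_Suc_I2)
        then show ?thesis by blast
      qed
    qed
  qed
  have ba: "(va i, w) \<in> ?r ^^ n" if w: "(vb i, w) \<in> ?r ^^ n" for n
  proof -
    obtain n' where n': "n = Suc n'" using w assms by (cases n) auto
    with w obtain y where y: "(vb i, y) \<in> ?r" "(y, w) \<in> ?r ^^ n'"
      by (meson relpow_Suc_D2)
    then have "(va i, y) \<in> ?r" by (auto simp: adj_bit_graph adj_bit_graph_del)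
    then show ?thesis using y n' by (metis relpow_Suc_I2)
  qed
  show "gdist (bit_graph m) (va i) w \<le> enat n \<longleftrightarrow> gdist (bit_graph m) (vb i) w \<le> enat n"
    unfolding gdist_le_iff[OF finite_simple_bit_graph in_verts_bit_graph(4)[OF assms(1)]]
      gdist_le_iff[OF finite_simple_bit_graph in_verts_bit_graph(5)[OF assms(1)]]
    using ab ba by (meson order_trans)
qed

text \<open>Only a vertex of the triple can separate \<open>va i\<close> from \<open>vb i\<close>,
  and the \<open>2 ^ m\<close> triples are disjoint.\<close>

lemma location_domination_number_bit_graph_ge:
  "2 ^ m \<le> location_domination_number k (bit_graph m)"
proof (rule location_domination_number_ge[OF finite_simple_bit_graph])
  fix S assume S: "dist_locating_dominating k (bit_graph m) S"
  then have "S \<subseteq> verts (bit_graph m)"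
    by (simp add: dist_locating_dominating_def dist_dominating_def)
  then have fin: "finite S"
    using finite_simple_bit_graph[of m] by (auto simp: finite_simple_graph_def intro: finite_subset)
  have hit: "{va i, vb i, vc i} \<inter> S \<noteq> {}" if "i \<in> {..<2 ^ m}" for i
  proof -
    have "\<exists>w\<in>S. gdist_trunc k (bit_graph m) (va i) w \<noteq> gdist_trunc k (bit_graph m) (vb i) w"
      using S that in_verts_bit_graph
      by (simp add: dist_locating_dominating_def dist_resolving_def)
    then obtain w where w: "w \<in> S"
      "gdist_trunc k (bit_graph m) (va i) w \<noteq> gdist_trunc k (bit_graph m) (vb i) w" by blast
    then have "w \<in> {va i, vb i, vc i}"
      using bit_graph_twins_equidistant[of i m w] that unfolding gdist_trunc_def by (metis lessThan_iff)
    then show ?thesis using w by blast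
  qed
  have "card {..<(2::nat) ^ m} \<le> card S"
    by (rule card_ge_if_disjoint_family_hit[OF fin _ hit]) auto
  then show "2 ^ m \<le> card S" by simp
qed

section \<open>Size of the gap\<close>

theorem theorem5p3:
  fixes k :: nat and N :: int
  assumes "k \<ge> 2"
  shows "\<exists>(G :: nat ugraph) e.
           finite_simple_graph G \<and> connected_graph G \<and>
           e \<in> edges G \<and> connected_graph (del_edge G e) \<and>
           int (location_domination_number k G)
             - int (location_domination_number k (del_edge G e)) \<ge> N"
proof -
  \<comment> \<open>The gap is at least \<open>2 ^ m - (m + 2)\<close>. The offset 3 starts the
    induction below at \<open>8 \<le> 2 ^ 3\<close>; a negative \<open>N\<close> is treated as 0 by
    \<open>nat\<close>.\<close>
  define m where "m = nat N + 3"
  have "2 * n + 8 \<le> (2::nat) ^ (n + 3)" for n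
    by (induction n) (simp add: power_add)+
  from this[of "nat N"] have pow: "m + nat N + 2 \<le> 2 ^ m" by (simp add: m_def)
  have "location_domination_number k (bit_graph_del m) \<le> card (landmarks m)"
    using bit_graph_del_locating_dominating[OF assms] by (rule location_domination_number_le)
  also have "\<dots> \<le> card {vu, vv} + card (vz ` {..<m})" by (rule card_Un_le)
  also have "\<dots> \<le> m + 2" using card_image_le[of "{..<m}" vz] by simp
  finally have "N \<le> int (location_domination_number k (bit_graph m))
      - int (location_domination_number k (bit_graph_del m))"
    using pow location_domination_number_bit_graph_ge[of m k] by linarith
  moreover have "{vu, vv} \<in> edges (bit_graph m)" by (simp add: bit_graph_def)
  ultimately show ?thesis
    using finite_simple_bit_graph connected_bit_graph_del connected_graph_del_edgeD by blast
qed

end
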